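(* Let $A$ be a finite-dimensional algebra over $\mathbb{C}$. Then $A$ admits an invertible local derivation if and only if it admits an invertible derivation.
   Context: An algebra is a finite-dimensional vector space over $\mathbb{C}$ equipped with a single bilinear multiplication (no further identities assumed). A derivation of $A$ is a linear map $D\colon A\to A$ with $D(xy)=D(x)y+xD(y)$ for all $x,y\in A$. A linear map $\Delta\colon A\to A$ is a local derivation if for every $x\in A$ there exists a derivation $D_x$ of $A$, depending on $x$, such that $\Delta(x)=D_x(x)$. Invertible means invertible as a linear map $A\to A$. *)

theory Defs
  imports Complex_Main
begin

locale fd_complex_algebra = vector_space scale
  for scale :: "complex \<Rightarrow> 'a::ab_group_add \<Rightarrow> 'a" (infixr \<open>*s\<close> 75) +
  fixes mult :: "'a \<Rightarrow> 'a \<Rightarrow> 'a" (infixl \<open>\<odot>\<close> 70)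
  assumes finite_dimensional: "\<exists>B. finite_dimensional_vector_space scale B"
    and linear_mult_left: "Vector_Spaces.linear scale scale (\<lambda>x. x \<odot> y)"
    and linear_mult_right: "Vector_Spaces.linear scale scale (\<lambda>y. x \<odot> y)"
begin

definition derivation :: "('a \<Rightarrow> 'a) \<Rightarrow> bool" where
  "derivation D \<longleftrightarrow>
     Vector_Spaces.linear scale scale D \<and> (\<forall>x y. D (x \<odot> y) = D x \<odot> y + x \<odot> D y)"

definition local_derivation :: "('a \<Rightarrow> 'a) \<Rightarrow> bool" where
  "local_derivation \<Delta> \<longleftrightarrow>
     Vector_Spaces.linear scale scale \<Delta> \<and> (\<forall>x. \<exists>D. derivation D \<and> \<Delta> x = D x)"

end

end

theory Submission
  imports Defs "Jordan_Normal_Form.Char_Poly"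
begin

text \<open>
  Only the linear structure of the space of derivations matters: if a linear space \<open>S\<close> of
  endomorphisms consists of singular maps and \<open>\<Delta> x \<in> S x\<close> for every \<open>x\<close>, then \<open>\<Delta>\<close> is
  singular. Suppose not, and let \<open>k\<close> be the least exponent for which the coefficient of
  \<open>\<lambda>\<^sup>k\<close> in \<open>det (h + \<lambda> \<Delta>)\<close> is nonzero for some \<open>h \<in> S\<close>; fix such an \<open>h\<close>. Choose
  \<open>x \<noteq> 0\<close> with \<open>h x = 0\<close> and \<open>d \<in> S\<close> with \<open>\<Delta> x = d x\<close>. Then \<open>h - \<lambda> d + \<lambda> \<Delta>\<close> kills
  \<open>x\<close> for all \<open>\<lambda>\<close>. But \<open>det (h - \<mu> d + \<lambda> \<Delta>)\<close> is divisible by \<open>\<lambda>\<^sup>k\<close>, so setting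
  \<open>\<mu> = \<lambda>\<close>, dividing by \<open>\<lambda>\<^sup>k\<close> and putting \<open>\<lambda> = 0\<close> shows that the coefficient of \<open>\<lambda>\<^sup>k\<close>
  in \<open>det (h + \<lambda> \<Delta>)\<close> vanishes, a contradiction.
\<close>

section \<open>Determinants of linear pencils of matrices\<close>

lemma det_map_mat_poly: "poly (det M) a = det (map_mat (\<lambda>p. poly p a) M)"
  by (rule comm_ring_hom.hom_det[OF poly_hom.comm_ring_hom_axioms, symmetric])

text \<open>Working over the polynomial ring makes \<open>det (A + \<lambda> B)\<close> a polynomial
  in \<lambda>, whose coefficients can be compared.\<close>

definition linear_pencil :: "nat \<Rightarrow> 'a::comm_ring_1 mat \<Rightarrow> 'a mat \<Rightarrow> 'a poly mat" where
  "linear_pencil n A B = mat n n (\<lambda>ij. [:A $$ ij, B $$ ij:])"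

lemma linear_pencil_carrier [simp]: "linear_pencil n A B \<in> carrier_mat n n"
  by (simp add: linear_pencil_def)

lemma map_mat_linear_pencil:
  "map_mat (\<lambda>p. poly p a) (linear_pencil n A B) = mat n n (\<lambda>ij. A $$ ij + a * B $$ ij)"
  by (rule eq_matI) (auto simp: linear_pencil_def)

lemma poly_det_linear_pencil:
  "poly (det (linear_pencil n A B)) a = det (mat n n (\<lambda>ij. A $$ ij + a * B $$ ij))"
  unfolding map_mat_linear_pencil[symmetric] by (rule det_map_mat_poly)

text \<open>The vector \<open>v\<close> lies in the kernel of \<open>A + a (B - C)\<close> for every
  scalar \<open>a\<close>, so the determinant vanishes at every point of an infinite field.\<close>

lemma det_linear_pencil_diff_eq_0:
  fixes A B C :: "'a::field_char_0 mat"
  assumes carrier: "A \<in> carrier_mat n n" "B \<in> carrier_mat n n" "C \<in> carrier_mat n n"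
    and v: "v \<in> carrier_vec n" "v \<noteq> 0\<^sub>v n"
    and Av: "A *\<^sub>v v = 0\<^sub>v n" and BC: "B *\<^sub>v v = C *\<^sub>v v"
  shows "det (linear_pencil n A (B - C)) = 0"
proof -
  have "poly (det (linear_pencil n A (B - C))) a = 0" for a
  proof -
    let ?M = "mat n n (\<lambda>ij. A $$ ij + a * (B - C) $$ ij)"
    have M: "?M = A + a \<cdot>\<^sub>m (B - C)"
      using carrier by (intro eq_matI) auto
    have "a \<cdot>\<^sub>m (B - C) *\<^sub>v v = a \<cdot>\<^sub>v ((B - C) *\<^sub>v v)"
      using carrier v by (intro eq_vecI) auto
    then have "?M *\<^sub>v v = A *\<^sub>v v + a \<cdot>\<^sub>v (B *\<^sub>v v - C *\<^sub>v v)"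
      unfolding M using carrier v
      by (subst add_mult_distrib_mat_vec[of _ n n]) (auto simp: minus_mult_distrib_mat_vec[of _ n n])
    also have "\<dots> = 0\<^sub>v n"
      using carrier v by (intro eq_vecI) (auto simp: Av BC)
    finally have "?M *\<^sub>v v = 0\<^sub>v n" .
    moreover have "?M \<in> carrier_mat n n" by simp
    ultimately have "det ?M = 0"
      using v det_0_iff_vec_prod_zero by blast
    then show ?thesis by (simp add: poly_det_linear_pencil)
  qed
  then show ?thesis using poly_all_0_iff_0 by blast
qed

text \<open>
  With \<open>Q(\<lambda>, \<mu>) = det (A - \<mu> C + \<lambda> B)\<close> divisible by \<open>\<lambda>\<^sup>k\<close>, the coefficient of
  \<open>\<lambda>\<^sup>k \<mu>\<^sup>0\<close> in \<open>Q\<close> is also the coefficient of \<open>\<lambda>\<^sup>k\<close> in \<open>Q(\<lambda>, \<lambda>)\<close>. In the proof,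
  \<open>Q\<close> is a polynomial in \<open>\<lambda>\<close> whose coefficients are polynomials in \<open>\<mu>\<close>.
\<close>

lemma coeff_det_linear_pencil_diff:
  fixes A B C :: "'a::field_char_0 mat"
  assumes carrier: "A \<in> carrier_mat n n" "B \<in> carrier_mat n n" "C \<in> carrier_mat n n"
    and low: "\<And>m j. j < k \<Longrightarrow> coeff (det (linear_pencil n (A - m \<cdot>\<^sub>m C) B)) j = 0"
  shows "coeff (det (linear_pencil n A (B - C))) k = coeff (det (linear_pencil n A B)) k"
proof -
  let ?M = "mat n n (\<lambda>ij. [:[:A $$ ij, - C $$ ij:], [:B $$ ij:]:])"
  define Q where "Q = det ?M"
  have inner: "map_poly (\<lambda>p. poly p m) Q = det (linear_pencil n (A - m \<cdot>\<^sub>m C) B)" for m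
  proof -
    interpret mp: map_poly_comm_ring_hom "\<lambda>p. poly p m" ..
    have "map_mat (map_poly (\<lambda>p. poly p m)) ?M = linear_pencil n (A - m \<cdot>\<^sub>m C) B"
      using carrier
      by (intro eq_matI poly_eqI) (auto simp: linear_pencil_def coeff_map_poly coeff_pCons split: nat.split)
    then show ?thesis unfolding Q_def by (simp only: mp.hom_det[symmetric])
  qed
  have coeff_Q: "poly (coeff Q j) m = coeff (det (linear_pencil n (A - m \<cdot>\<^sub>m C) B)) j" for j m
    unfolding inner[symmetric] by (simp add: coeff_map_poly)
  \<comment> \<open>Substituting the inner variable \<open>[:0, 1:]\<close> for the outer one sets
    \<lambda> = \<mu>.\<close>
  have diagonal: "poly Q [:0, 1:] = det (linear_pencil n A (B - C))"
  proof -
    have "map_mat (\<lambda>p. poly p [:0, 1:]) ?M = linear_pencil n A (B - C)"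
      using carrier by (intro eq_matI) (auto simp: linear_pencil_def)
    then show ?thesis unfolding Q_def by (simp only: det_map_mat_poly)
  qed
  have "coeff Q j = 0" if "j < k" for j
    using coeff_Q[of j] low[OF that] poly_all_0_iff_0 by metis
  then have "monom 1 k dvd Q" by (simp add: monom_1_dvd_iff')
  then obtain R where R: "Q = monom 1 k * R" by (auto simp: dvd_def)
  \<comment> \<open>The substitution turns the outer monomial into the inner one of the same degree,
    so the coefficient sought is the value of \<open>R\<close> at \<lambda> = \<mu> = 0.\<close>
  have "poly Q [:0, 1:] = monom 1 k * poly R [:0, 1:]"
    by (simp add: R poly_monom monom_altdef)
  then have "coeff (poly Q [:0, 1:]) k = poly (poly R [:0, 1:]) 0"
    by (simp add: coeff_monom_mult poly_0_coeff_0)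
  also have "\<dots> = poly (coeff R 0) 0"
    by (cases R) simp
  also have "\<dots> = poly (coeff Q k) 0"
    by (simp add: R coeff_monom_mult)
  also have "\<dots> = coeff (det (linear_pencil n (A - 0 \<cdot>\<^sub>m C) B)) k"
    by (rule coeff_Q)
  also have "A - 0 \<cdot>\<^sub>m C = A"
    using carrier by (intro eq_matI) auto
  finally show ?thesis by (simp add: diagonal)
qed

text \<open>The conditions on zero and on differences make \<open>S\<close> a linear subspace. The
  scalar \<open>m\<close> stands for \<mu>: minimality of the exponent has to cover every
  \<open>A - m C\<close>.\<close>

lemma det_eq_0_if_locally_in_singular_subspace:
  fixes S :: "'a::field_char_0 mat set"
  assumes S: "S \<subseteq> carrier_mat n n" "0\<^sub>m n n \<in> S"
    and closed: "\<And>A C m. A \<in> S \<Longrightarrow> C \<in> S \<Longrightarrow> A - m \<cdot>\<^sub>m C \<in> S"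
    and singular: "\<And>A. A \<in> S \<Longrightarrow> det A = 0"
    and B: "B \<in> carrier_mat n n"
    and local: "\<And>v. v \<in> carrier_vec n \<Longrightarrow> \<exists>C\<in>S. B *\<^sub>v v = C *\<^sub>v v"
  shows "det B = 0"
proof (rule ccontr)
  assume "det B \<noteq> 0"
  let ?P = "\<lambda>A. det (linear_pencil n A B)"
  \<comment> \<open>At \<open>A = 0\<close> and \<lambda> = 1 the pencil is \<open>B\<close> itself,
    so some coefficient is nonzero and a least exponent exists.\<close>
  have "mat n n (\<lambda>ij. 0\<^sub>m n n $$ ij + 1 * B $$ ij) = B"
    using B by (intro eq_matI) auto
  then have "poly (?P (0\<^sub>m n n)) 1 \<noteq> 0"
    using \<open>det B \<noteq> 0\<close> by (simp add: poly_det_linear_pencil)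
  then have "?P (0\<^sub>m n n) \<noteq> 0" by auto
  then have ex: "\<exists>k. \<exists>A\<in>S. coeff (?P A) k \<noteq> 0"
    using S(2) by (meson leading_coeff_neq_0)
  define k where "k = (LEAST k. \<exists>A\<in>S. coeff (?P A) k \<noteq> 0)"
  obtain A where A: "A \<in> S" "coeff (?P A) k \<noteq> 0"
    using LeastI_ex[OF ex] unfolding k_def by blast
  have low: "coeff (?P A) j = 0" if "A \<in> S" "j < k" for A j
    using not_less_Least[of j "\<lambda>k. \<exists>A\<in>S. coeff (?P A) k \<noteq> 0"] that unfolding k_def by blast
  have Ac: "A \<in> carrier_mat n n" using A S by blast
  obtain v where v: "v \<in> carrier_vec n" "v \<noteq> 0\<^sub>v n" "A *\<^sub>v v = 0\<^sub>v n"
    using det_0_iff_vec_prod_zero[OF Ac] singular[OF A(1)] by blast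
  obtain C where C: "C \<in> S" "B *\<^sub>v v = C *\<^sub>v v"
    using local v(1) by blast
  have Cc: "C \<in> carrier_mat n n" using C S by blast
  have "coeff (?P A) k = coeff (det (linear_pencil n A (B - C))) k"
    by (rule coeff_det_linear_pencil_diff[OF Ac B Cc, symmetric]) (use low closed A C in blast)
  also have "\<dots> = 0"
    by (simp add: det_linear_pencil_diff_eq_0[OF Ac B Cc v(1,2,3) C(2)])
  finally show False using A(2) by simp
qed

section \<open>Coordinates, and the passage from matrices to linear maps\<close>

context finite_dimensional_vector_space
begin

text \<open>The list \<open>bs\<close> is meant to enumerate \<open>Basis\<close>; it fixes the
  order that indexing by natural numbers requires.\<close>

definition coord_vec :: "'b list \<Rightarrow> 'b \<Rightarrow> 'a vec" where
  "coord_vec bs x = vec (length bs) (\<lambda>i. representation Basis x (bs ! i))"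

definition matrix_of :: "'b list \<Rightarrow> ('b \<Rightarrow> 'b) \<Rightarrow> 'a mat" where
  "matrix_of bs f =
     mat (length bs) (length bs) (\<lambda>(i, j). representation Basis (f (bs ! j)) (bs ! i))"

lemma coord_vec_carrier [simp]: "coord_vec bs x \<in> carrier_vec (length bs)"
  by (simp add: coord_vec_def)

lemma matrix_of_carrier [simp]: "matrix_of bs f \<in> carrier_mat (length bs) (length bs)"
  by (simp add: matrix_of_def)

lemma in_span_Basis [simp]: "x \<in> span Basis"
  by (simp add: span_Basis)

context
  fixes bs :: "'b list"
  assumes bs: "distinct bs" "set bs = Basis"
begin

lemma sum_nth_Basis: "(\<Sum>i<length bs. g (bs ! i)) = sum g Basis"
  using bs sum.reindex_bij_betw[OF bij_betw_nth[of bs "{..<length bs}" Basis]] by auto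

lemma representation_linear_combination:
  "representation Basis (\<Sum>j\<in>J. c j *s g j) b = (\<Sum>j\<in>J. c j * representation Basis (g j) b)"
  by (simp add: representation_sum representation_scale independent_Basis span_scale)

lemma matrix_of_mult_coord_vec:
  assumes "Vector_Spaces.linear scale scale f"
  shows "matrix_of bs f *\<^sub>v coord_vec bs x = coord_vec bs (f x)"
proof (rule eq_vecI)
  interpret f: Vector_Spaces.linear scale scale f by fact
  fix i assume "i < dim_vec (coord_vec bs (f x))"
  then have i: "i < length bs" by (simp add: coord_vec_def)
  have "x = (\<Sum>j<length bs. representation Basis x (bs ! j) *s bs ! j)"
    using sum_representation_eq[OF independent_Basis _ finite_Basis, of x]
    by (simp add: sum_nth_Basis[of "\<lambda>b. representation Basis x b *s b"])
  then have "f x = (\<Sum>j<length bs. representation Basis x (bs ! j) *s f (bs ! j))"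
    by (metis (no_types, lifting) f.scale f.sum sum.cong)
  then have "representation Basis (f x) (bs ! i) =
      (\<Sum>j<length bs. representation Basis x (bs ! j) * representation Basis (f (bs ! j)) (bs ! i))"
    by (simp only: representation_linear_combination)
  then show "(matrix_of bs f *\<^sub>v coord_vec bs x) $ i = coord_vec bs (f x) $ i"
    using i by (simp add: matrix_of_def coord_vec_def scalar_prod_def mult.commute atLeast0LessThan)
qed (simp add: matrix_of_def coord_vec_def)

lemma ex_coord_vec:
  assumes "v \<in> carrier_vec (length bs)"
  shows "\<exists>x. coord_vec bs x = v"
proof
  show "coord_vec bs (\<Sum>j<length bs. v $ j *s bs ! j) = v"
  proof (rule eq_vecI)
    fix i assume "i < dim_vec v"
    then have i: "i < length bs" using assms by simp
    \<comment> \<open>Coordinates of basis vectors are Kronecker deltas, as \<open>bs\<close> has no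
      repetitions.\<close>
    have "(\<Sum>j<length bs. v $ j * representation Basis (bs ! j) (bs ! i)) =
        (\<Sum>j<length bs. if j = i then v $ j else 0)"
    proof (rule sum.cong)
      fix j assume "j \<in> {..<length bs}"
      then have "bs ! j \<in> Basis" "bs ! i = bs ! j \<longleftrightarrow> i = j"
        using bs i by (auto simp: nth_eq_iff_index_eq)
      then show "v $ j * representation Basis (bs ! j) (bs ! i) = (if j = i then v $ j else 0)"
        by (simp add: representation_basis[OF independent_Basis])
    qed simp
    then show "coord_vec bs (\<Sum>j<length bs. v $ j *s bs ! j) $ i = v $ i"
      using i by (simp add: coord_vec_def representation_linear_combination)
  qed (use assms in \<open>simp add: coord_vec_def\<close>)
qed

lemma coord_vec_eq_0_iff: "coord_vec bs x = 0\<^sub>v (length bs) \<longleftrightarrow> x = 0"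
proof
  assume 0: "coord_vec bs x = 0\<^sub>v (length bs)"
  have "representation Basis x (bs ! i) = 0" if "i < length bs" for i
    using arg_cong[OF 0, of "\<lambda>v. v $ i"] that by (simp add: coord_vec_def)
  then have "\<forall>b\<in>Basis. representation Basis x b = 0"
    using bs by (metis in_set_conv_nth)
  then show "x = 0"
    using sum_representation_eq[OF independent_Basis _ finite_Basis, of x] by simp
qed (auto simp: coord_vec_def representation_zero)

text \<open>Coordinates identify the kernel of the matrix with that of \<open>f\<close>, and in
  finite dimension an injective endomorphism is surjective.\<close>

lemma det_matrix_of_eq_0_iff:
  assumes f: "Vector_Spaces.linear scale scale f"
  shows "det (matrix_of bs f) = 0 \<longleftrightarrow> \<not> bij f"
proof -
  interpret f: Vector_Spaces.linear scale scale f by fact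
  have "det (matrix_of bs f) = 0 \<longleftrightarrow>
      (\<exists>v. v \<in> carrier_vec (length bs) \<and> v \<noteq> 0\<^sub>v (length bs) \<and>
        matrix_of bs f *\<^sub>v v = 0\<^sub>v (length bs))"
    by (rule det_0_iff_vec_prod_zero) simp
  also have "\<dots> \<longleftrightarrow> (\<exists>x. x \<noteq> 0 \<and> f x = 0)"
    using ex_coord_vec coord_vec_carrier coord_vec_eq_0_iff matrix_of_mult_coord_vec[OF f] by metis
  also have "\<dots> \<longleftrightarrow> \<not> inj f"
    using f.inj_iff_eq_0 by blast
  also have "\<dots> \<longleftrightarrow> \<not> bij f"
    using linear_inj_imp_surj[OF f] by (auto simp: bij_def)
  finally show ?thesis .
qed

lemma matrix_of_diff_scale:
  "matrix_of bs (\<lambda>x. f x - m *s g x) = matrix_of bs f - m \<cdot>\<^sub>m matrix_of bs g"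
  by (rule eq_matI) (auto simp: matrix_of_def representation_diff representation_scale independent_Basis)

lemma matrix_of_0: "matrix_of bs (\<lambda>x. 0) = 0\<^sub>m (length bs) (length bs)"
  by (rule eq_matI) (auto simp: matrix_of_def representation_zero)

end

end

text \<open>If no member of \<open>S\<close> were bijective, the matrices of \<open>S\<close> would
  form a singular subspace that locally contains the matrix of \<Delta>, which would then be
  singular too.\<close>

lemma ex_bij_if_locally_in_subspace:
  fixes scale :: "'k::field_char_0 \<Rightarrow> 'v::ab_group_add \<Rightarrow> 'v"
  assumes fd: "finite_dimensional_vector_space scale Basis"
    and S: "\<And>f. f \<in> S \<Longrightarrow> Vector_Spaces.linear scale scale f" "(\<lambda>x. 0) \<in> S"
      "\<And>f g m. f \<in> S \<Longrightarrow> g \<in> S \<Longrightarrow> (\<lambda>x. f x - scale m (g x)) \<in> S"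
    and \<Delta>: "Vector_Spaces.linear scale scale \<Delta>" "bij \<Delta>"
    and local: "\<And>x. \<exists>f\<in>S. \<Delta> x = f x"
  shows "\<exists>f\<in>S. bij f"
proof (rule ccontr)
  assume no_bij: "\<not> (\<exists>f\<in>S. bij f)"
  interpret finite_dimensional_vector_space scale Basis by fact
  obtain bs where bs: "distinct bs" "set bs = Basis"
    using finite_distinct_list[OF finite_Basis] by blast
  have "det (matrix_of bs \<Delta>) = 0"
  proof (rule det_eq_0_if_locally_in_singular_subspace[of "matrix_of bs ` S" "length bs"])
    show "0\<^sub>m (length bs) (length bs) \<in> matrix_of bs ` S"
      using S(2) matrix_of_0[OF bs] by (metis imageI)
    show "A - m \<cdot>\<^sub>m C \<in> matrix_of bs ` S"
      if "A \<in> matrix_of bs ` S" "C \<in> matrix_of bs ` S" for A C m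
      using that S(3) by (force simp flip: matrix_of_diff_scale[OF bs])
    show "det A = 0" if "A \<in> matrix_of bs ` S" for A
      using that no_bij S(1) det_matrix_of_eq_0_iff[OF bs] by blast
    show "\<exists>C\<in>matrix_of bs ` S. matrix_of bs \<Delta> *\<^sub>v v = C *\<^sub>v v"
      if "v \<in> carrier_vec (length bs)" for v
    proof -
      obtain x where x: "coord_vec bs x = v"
        using ex_coord_vec[OF bs] \<open>v \<in> carrier_vec (length bs)\<close> by blast
      obtain f where "f \<in> S" "\<Delta> x = f x" using local by blast
      then have "matrix_of bs \<Delta> *\<^sub>v v = matrix_of bs f *\<^sub>v v"
        using matrix_of_mult_coord_vec[OF bs \<Delta>(1), of x] matrix_of_mult_coord_vec[OF bs S(1), of f x]
        by (simp add: x)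
      then show ?thesis using \<open>f \<in> S\<close> by blast
    qed
  qed auto
  then show False using det_matrix_of_eq_0_iff[OF bs \<Delta>(1)] \<Delta>(2) by blast
qed

section \<open>The linear space of derivations\<close>

context fd_complex_algebra
begin

lemma derivation_zero: "derivation (\<lambda>x. 0)"
proof -
  have "x \<odot> 0 = 0" "0 \<odot> x = 0" for x
    using module_hom.zero[of scale scale "\<lambda>y. x \<odot> y"] module_hom.zero[of scale scale "\<lambda>y. y \<odot> x"]
      linear_mult_left linear_mult_right
    by (simp_all add: Vector_Spaces.linear_iff_module_hom)
  then show ?thesis
    by (simp add: derivation_def Vector_Spaces.linear_iff_module_hom module_hom_iff module_axioms)
qed

text \<open>Bilinearity of the product makes the product rule a linear condition on the map. With
  \<open>derivation_zero\<close> this lets the derivations serve as the subspace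
  \<open>S\<close>.\<close>

lemma derivation_diff_scale:
  assumes "derivation D" "derivation E"
  shows "derivation (\<lambda>x. D x - m *s E x)"
proof -
  have lin: "module_hom scale scale D" "module_hom scale scale E"
    using assms by (auto simp: derivation_def Vector_Spaces.linear_iff_module_hom)
  interpret l: module_hom scale scale "\<lambda>x. x \<odot> y" for y
    using linear_mult_left by (simp add: Vector_Spaces.linear_iff_module_hom)
  interpret r: module_hom scale scale "\<lambda>y. x \<odot> y" for x
    using linear_mult_right by (simp add: Vector_Spaces.linear_iff_module_hom)
  have "module_hom scale scale (\<lambda>x. D x - m *s E x)"
    using lin by (simp add: module_hom_iff scale_right_distrib scale_right_diff_distrib mult.commute)
  moreover have "D (x \<odot> y) - m *s E (x \<odot> y) = (D x - m *s E x) \<odot> y + x \<odot> (D y - m *s E y)" for x y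
    using assms
    by (simp add: derivation_def l.diff r.diff l.scale r.scale scale_right_distrib)
  ultimately show ?thesis by (simp add: derivation_def Vector_Spaces.linear_iff_module_hom)
qed

end

theorem theorem2p18:
  fixes scale :: "complex \<Rightarrow> 'a::ab_group_add \<Rightarrow> 'a"
    and mult :: "'a \<Rightarrow> 'a \<Rightarrow> 'a"
  assumes "fd_complex_algebra scale mult"
  shows "(\<exists>\<Delta>. fd_complex_algebra.local_derivation scale mult \<Delta> \<and> bij \<Delta>) \<longleftrightarrow>
         (\<exists>D. fd_complex_algebra.derivation scale mult D \<and> bij D)"
proof -
  interpret fd_complex_algebra scale mult by fact
  obtain Basis where fd: "finite_dimensional_vector_space scale Basis"
    using finite_dimensional by blast
  show ?thesis
  proof
    assume "\<exists>\<Delta>. local_derivation \<Delta> \<and> bij \<Delta>"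
    then obtain \<Delta> where "local_derivation \<Delta>" "bij \<Delta>" by blast
    then have "\<exists>D\<in>Collect derivation. bij D"
      by (intro ex_bij_if_locally_in_subspace[OF fd, where \<Delta> = \<Delta>])
        (auto simp: local_derivation_def derivation_zero derivation_diff_scale, auto simp: derivation_def)
    then show "\<exists>D. derivation D \<and> bij D" by blast
  next
    assume "\<exists>D. derivation D \<and> bij D"
    \<comment> \<open>A derivation is its own witness at every point.\<close>
    then show "\<exists>\<Delta>. local_derivation \<Delta> \<and> bij \<Delta>"
      unfolding local_derivation_def derivation_def by blast
  qed
qed

end
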